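(* There exist a finite set $V$ and a subsystem $\vec S$ of the bipartition universe $\vec U=\mathcal B(V)$ such that $\vec S$ is submodular in $\vec U$, but there are no submodular order function $f\colon\vec U\to\mathbb R_{\ge 0}$ and $k\in\mathbb R_{\ge 0}$ with $\vec S=\{s\in\vec U\mid f(s)<k\}$.
   Context: For a set $V$, the bipartition universe $\mathcal B(V)$ is the lattice of all subsets of $V$ ordered by inclusion (join is union, meet is intersection) with the order-reversing involution $A^*=V\setminus A$. A subsystem of $\mathcal B(V)$ is a subset closed under the involution. A subsystem $\vec S$ is submodular in $\vec U$ if for all $r,s\in\vec S$ at least one of $r\vee s$ and $r\wedge s$ (taken in $\vec U$) lies in $\vec S$. A submodular order function on $\vec U$ is a function $f\colon\vec U\to\mathbb R_{\ge 0}$ with $f(r\vee s)+f(r\wedge s)\le f(r)+f(s)$ for all $r,s\in\vec U$ and $f(s)=f(s^* )$ for all $s\in\vec U$. *)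

theory Defs
  imports Complex_Main
begin

text \<open>
  The bipartition universe of \<open>V\<close> has carrier \<open>Pow V\<close>, join \<open>\<union>\<close>, meet \<open>\<inter>\<close>,
  and the order-reversing involution below.
\<close>

definition bipartition_universe :: "'a set \<Rightarrow> 'a set set" where
  "bipartition_universe V = Pow V"

definition bipartition_inv :: "'a set \<Rightarrow> 'a set \<Rightarrow> 'a set" where
  "bipartition_inv V A = V - A"

definition subsystem :: "'a set \<Rightarrow> 'a set set \<Rightarrow> bool" where
  "subsystem V S \<longleftrightarrow>
     S \<subseteq> bipartition_universe V \<and> (\<forall>s\<in>S. bipartition_inv V s \<in> S)"

definition submodular_system :: "'a set set \<Rightarrow> bool" where
  "submodular_system S \<longleftrightarrow> (\<forall>r\<in>S. \<forall>s\<in>S. r \<union> s \<in> S \<or> r \<inter> s \<in> S)"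

text \<open>
  Order functions are total in HOL; only their values on the bipartition universe are
  constrained.
\<close>

definition submodular_order_function :: "'a set \<Rightarrow> ('a set \<Rightarrow> real) \<Rightarrow> bool" where
  "submodular_order_function V f \<longleftrightarrow>
     (\<forall>s\<in>bipartition_universe V. 0 \<le> f s) \<and>
     (\<forall>r\<in>bipartition_universe V. \<forall>s\<in>bipartition_universe V.
        f (r \<union> s) + f (r \<inter> s) \<le> f r + f s) \<and>
     (\<forall>s\<in>bipartition_universe V. f s = f (bipartition_inv V s))"

end

theory Submission
  imports Defs "HOL-Library.Nat_Bijection"
begin

text \<open>
  Split \<open>V = {0, \<dots>, 5}\<close> into the pairs \<open>P = {0, 3}\<close>, \<open>Q = {1, 4}\<close>, \<open>R = {2, 5}\<close>. The system consists
  of \<open>\<emptyset>\<close>, \<open>{0}\<close>, \<open>{1}\<close>, \<open>{2}\<close>, \<open>P\<close>, \<open>Q\<close>, \<open>R\<close>, \<open>P \<union> {2}\<close>, \<open>Q \<union> {0}\<close>, \<open>R \<union> {1}\<close> and their complements.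
  Its members \<open>P \<union> Q\<close> and \<open>P \<union> {2}\<close> have meet \<open>P\<close>, while their join \<open>V - {5}\<close> lies outside it.
  Hence every order function \<open>f\<close> inducing the system satisfies \<open>f P < f (P \<union> Q) = f R\<close>.
  Rotating the pairs cyclically also gives \<open>f R < f Q\<close> and \<open>f Q < f P\<close>, a contradiction.

  Subsets of \<open>V\<close> are encoded by bit masks, so that \<open>V\<close>, \<open>P\<close>, \<open>Q\<close>, \<open>R\<close> become 63, 9, 18, 36 and
  membership in the system is decided by computing with numerals.
\<close>

lemma set_decode_or: "set_decode (or m n) = set_decode m \<union> set_decode n"
  by (auto simp: set_decode_def bit_or_iff simp flip: bit_iff_odd)

lemma set_decode_and: "set_decode (and m n) = set_decode m \<inter> set_decode n"
  by (auto simp: set_decode_def bit_and_iff simp flip: bit_iff_odd)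

text \<open>Since \<open>and m n\<close> is a submask of \<open>m\<close>, the \<open>xor\<close>
  merely clears its bits.\<close>

lemma set_decode_xor_and: "set_decode (xor m (and m n)) = set_decode m - set_decode n"
  by (auto simp: set_decode_def bit_and_iff bit_xor_iff simp flip: bit_iff_odd)

text \<open>The last ten masks are the complements of the first ten, in the same order.\<close>

definition cyclic_masks :: "nat set" where
  "cyclic_masks =
     {0, 1, 2, 4, 9, 18, 36, 13, 19, 38, 63, 62, 61, 59, 54, 45, 27, 50, 44, 25}"

lemma cyclic_masks_or_and:
  "\<forall>m\<in>cyclic_masks. \<forall>n\<in>cyclic_masks. or m n \<in> cyclic_masks \<or> and m n \<in> cyclic_masks"
  by (simp add: cyclic_masks_def)

lemma cyclic_masks_complement:
  "m \<in> cyclic_masks \<Longrightarrow> and 63 m = m \<and> xor 63 (and 63 m) \<in> cyclic_masks"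
  by (auto simp: cyclic_masks_def)

definition cyclic_system :: "nat set set" where
  "cyclic_system = set_decode ` cyclic_masks"

lemma set_decode_in_cyclic_system_iff [simp]:
  "set_decode m \<in> cyclic_system \<longleftrightarrow> m \<in> cyclic_masks"
  unfolding cyclic_system_def by (metis imageE imageI set_decode_inverse)

lemma subsystem_cyclic_system: "subsystem (set_decode 63) cyclic_system"
proof -
  have "set_decode m \<subseteq> set_decode 63" "set_decode 63 - set_decode m \<in> cyclic_system"
    if "m \<in> cyclic_masks" for m
    using cyclic_masks_complement[OF that] set_decode_and[of 63 m]
    by (auto simp del: set_decode_zero simp flip: set_decode_xor_and)
  then show ?thesis
    by (auto simp: subsystem_def bipartition_universe_def bipartition_inv_def
        cyclic_system_def)
qed

lemma submodular_cyclic_system: "submodular_system cyclic_system"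
  using cyclic_masks_or_and
  by (force simp: submodular_system_def cyclic_system_def simp flip: set_decode_or set_decode_and)

text \<open>As the join lies outside \<open>S\<close>, its order is at least \<open>k\<close> and so
  exceeds \<open>f s\<close>; submodularity forces a compensating drop at the meet.\<close>

lemma order_meet_less:
  assumes f: "submodular_order_function V f"
    and S: "S = {s \<in> bipartition_universe V. f s < k}"
    and "r \<in> S" "s \<in> S" "r \<union> s \<notin> S"
  shows "f (r \<inter> s) < f r"
proof -
  have rs: "r \<in> bipartition_universe V" "s \<in> bipartition_universe V" and "f s < k"
    using assms(3,4) by (auto simp: S)
  moreover have "k \<le> f (r \<union> s)"
    using assms(5) rs by (auto simp: S bipartition_universe_def)
  moreover have "f (r \<union> s) + f (r \<inter> s) \<le> f r + f s"
    using f rs unfolding submodular_order_function_def by blast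
  ultimately show ?thesis by linarith
qed

theorem theorem2:
  "\<exists>(V :: nat set) (S :: nat set set).
     finite V \<and> subsystem V S \<and> submodular_system S \<and>
     \<not> (\<exists>(f :: nat set \<Rightarrow> real) (k :: real).
          submodular_order_function V f \<and> 0 \<le> k \<and>
          S = {s \<in> bipartition_universe V. f s < k})"
proof (intro exI conjI notI)
  let ?V = "set_decode 63"
  show "finite ?V" by (rule finite_set_decode)
  show "subsystem ?V cyclic_system" by (rule subsystem_cyclic_system)
  show "submodular_system cyclic_system" by (rule submodular_cyclic_system)
  assume "\<exists>f k. submodular_order_function ?V f \<and> 0 \<le> k \<and>
    cyclic_system = {s \<in> bipartition_universe ?V. f s < k}"
  then obtain f :: "nat set \<Rightarrow> real" and k where f: "submodular_order_function ?V f"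
    and S: "cyclic_system = {s \<in> bipartition_universe ?V. f s < k}"
    by blast
  have less: "f (set_decode (and m n)) < f (set_decode (xor 63 (and 63 m)))"
    if "m \<in> cyclic_masks" "n \<in> cyclic_masks" "or m n \<notin> cyclic_masks" for m n
  proof -
    have "set_decode m \<in> bipartition_universe ?V"
      using subsystem_cyclic_system that(1) by (auto simp: subsystem_def)
    then have "f (set_decode m) = f (set_decode (xor 63 (and 63 m)))"
      using f by (simp add: submodular_order_function_def bipartition_inv_def set_decode_xor_and)
    moreover have "f (set_decode m \<inter> set_decode n) < f (set_decode m)"
      using that by (intro order_meet_less[OF f S]) (simp_all flip: set_decode_or)
    ultimately show ?thesis by (simp add: set_decode_and)
  qed
  \<comment> \<open>27 and 13 encode P \<union> Q and P \<union> {2}, with join 31, that is V - {5};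
    the other two instances are rotations.\<close>
  have "f (set_decode 9) < f (set_decode 36)"
    using less[of 27 13] by (simp add: cyclic_masks_def)
  moreover have "f (set_decode 36) < f (set_decode 18)"
    using less[of 45 38] by (simp add: cyclic_masks_def)
  moreover have "f (set_decode 18) < f (set_decode 9)"
    using less[of 54 19] by (simp add: cyclic_masks_def)
  ultimately show False by linarith
qed

end
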